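(* Let $\varphi:M\to N$ be a diffeomorphism between $n$-dimensional Riemannian manifolds. Then $\varphi$ is locally leafwise conformal if for every $x\in M$ there are foliated conformal charts $\psi$ and $\tilde\psi$ in neighbourhoods of $x$ and $\varphi(x)$ respectively, such that $$\tilde\psi\circ\varphi\circ\psi^{-1}(z,q)=(h(z,q),q),$$ where for every $q\in\mathbb{R}^{n-2}$ the map $\mathbb{R}^2\ni z\mapsto h(z,q)\in\mathbb{R}^2$ is holomorphic (with $\mathbb{R}^2=\mathbb{C}$).
   Context: All maps are smooth, and maps written in charts are considered where they are defined. A diffeomorphism $\varphi:M\to N$ between Riemannian manifolds is leafwise conformal if there is a $2$-dimensional foliation $\mathcal F$ on $M$ such that $\varphi:L\to\varphi(L)$ is conformal (for the induced metrics) for every leaf $L\in\mathcal F$. It is locally leafwise conformal if every $x\in M$ has a neighbourhood $U$ such that $\varphi:U\to\varphi(U)$ is leafwise conformal. A coordinate system $\psi$, with values in $\mathbb{R}^2\times\mathbb{R}^{n-2}$, on an $n$-dimensional Riemannian manifold $(M,g)$ is called a foliated conformal chart if the map $z\mapsto\psi^{-1}(z,q)$, $z\in\mathbb{R}^2$, $q\in\mathbb{R}^{n-2}$, is conformal (for the Euclidean metric on $\mathbb{R}^2$ and $g$) for all $q$. *)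

theory Defs
  imports "HOL-Analysis.Analysis"
begin

text \<open>
  \<open>\<real>\<^sup>n\<close> with \<open>n \<ge> 2\<close> is modelled as \<open>complex \<times> 'q\<close>, where \<open>'q\<close> plays the role of \<open>\<real>\<^sup>n\<^sup>-\<^sup>2\<close>.
  The class \<open>euclidean_space\<close> excludes dimension \<open>0\<close>, i.e. \<open>n = 2\<close>, so \<open>'q\<close> ranges over all
  finite-dimensional inner product spaces instead: \<open>unit\<close> is \<open>\<real>\<^sup>0\<close>, and every Euclidean space
  is an instance.
\<close>

class findim_inner = real_inner +
  assumes ex_finite_span: "\<exists>B. finite B \<and> (\<forall>x. \<exists>c. x = (\<Sum>b\<in>B. c b *\<^sub>R b))"

instance euclidean_space \<subseteq> findim_inner
proof
  show "\<exists>B::'a set. finite B \<and> (\<forall>x. \<exists>c. x = (\<Sum>b\<in>B. c b *\<^sub>R b))"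
    by (rule exI[of _ Basis]) (metis euclidean_representation finite_Basis)
qed

instantiation unit :: real_inner
begin

definition plus_unit :: "unit \<Rightarrow> unit \<Rightarrow> unit" where "plus_unit x y = ()"
definition zero_unit :: unit where "zero_unit = ()"
definition scaleR_unit :: "real \<Rightarrow> unit \<Rightarrow> unit" where "scaleR_unit r x = ()"
definition inner_unit :: "unit \<Rightarrow> unit \<Rightarrow> real" where "inner_unit x y = 0"
definition norm_unit :: "unit \<Rightarrow> real" where "norm_unit x = 0"
definition sgn_unit :: "unit \<Rightarrow> unit" where "sgn_unit x = ()"
definition dist_unit :: "unit \<Rightarrow> unit \<Rightarrow> real" where "dist_unit x y = 0"
definition uniformity_unit :: "(unit \<times> unit) filter" where
  "uniformity_unit = (INF e\<in>{0 <..}. principal {(x, y). dist x y < e})"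
definition open_unit :: "unit set \<Rightarrow> bool" where
  "open_unit U \<longleftrightarrow> (\<forall>x\<in>U. eventually (\<lambda>(x', y). x' = x \<longrightarrow> y \<in> U) uniformity)"

instance
  by standard (auto simp: inner_unit_def norm_unit_def dist_unit_def
      uniformity_unit_def open_unit_def)

end

instance unit :: findim_inner
proof
  show "\<exists>B::unit set. finite B \<and> (\<forall>x. \<exists>c. x = (\<Sum>b\<in>B. c b *\<^sub>R b))"
    by (rule exI[of _ UNIV]) auto
qed


text \<open>Iterated directional derivatives; in finite dimension and for open \<open>S\<close> this is the usual \<open>C\<^sup>k\<close>.\<close>

fun Ck_on :: "nat \<Rightarrow> 'a::real_normed_vector set \<Rightarrow> ('a \<Rightarrow> 'b::real_normed_vector) \<Rightarrow> bool" where
  "Ck_on 0 S f \<longleftrightarrow> continuous_on S f"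
| "Ck_on (Suc k) S f \<longleftrightarrow> (\<forall>x\<in>S. f differentiable (at x)) \<and>
     (\<forall>v. Ck_on k S (\<lambda>x. frechet_derivative f (at x) v))"

definition smooth_on :: "'a::real_normed_vector set \<Rightarrow> ('a \<Rightarrow> 'b::real_normed_vector) \<Rightarrow> bool" where
  "smooth_on S f \<longleftrightarrow> (\<forall>k. Ck_on k S f)"

text \<open>A chart is its domain together with its coordinate map; the values of the coordinate map
  outside the domain are irrelevant.\<close>

type_synonym ('m, 'e) chart = "'m set \<times> ('m \<Rightarrow> 'e)"

abbreviation chart_dom :: "('m, 'e) chart \<Rightarrow> 'm set" where
  "chart_dom c \<equiv> fst c"

abbreviation chart_map :: "('m, 'e) chart \<Rightarrow> 'm \<Rightarrow> 'e" where
  "chart_map c \<equiv> snd c"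

definition chart_inv :: "('m, 'e) chart \<Rightarrow> 'e \<Rightarrow> 'm" where
  "chart_inv c = inv_into (chart_dom c) (chart_map c)"

definition topological_chart :: "'m topology \<Rightarrow> ('m, 'e::topological_space) chart \<Rightarrow> bool" where
  "topological_chart X c \<longleftrightarrow>
     openin X (chart_dom c) \<and>
     open (chart_map c ` chart_dom c) \<and>
     homeomorphic_map (subtopology X (chart_dom c)) (top_of_set (chart_map c ` chart_dom c))
       (chart_map c)"

definition smooth_compatible ::
  "('m, 'e::real_normed_vector) chart \<Rightarrow> ('m, 'e) chart \<Rightarrow> bool" where
  "smooth_compatible c d \<longleftrightarrow>
     smooth_on (chart_map c ` (chart_dom c \<inter> chart_dom d)) (chart_map d \<circ> chart_inv c) \<and>
     smooth_on (chart_map d ` (chart_dom c \<inter> chart_dom d)) (chart_map c \<circ> chart_inv d)"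

definition maximal_smooth_atlas ::
  "'m topology \<Rightarrow> ('m, 'e::real_normed_vector) chart set \<Rightarrow> bool" where
  "maximal_smooth_atlas X A \<longleftrightarrow>
     (\<forall>c\<in>A. topological_chart X c) \<and>
     (\<Union>c\<in>A. chart_dom c) = topspace X \<and>
     (\<forall>c\<in>A. \<forall>d\<in>A. smooth_compatible c d) \<and>
     (\<forall>c. topological_chart X c \<and> (\<forall>d\<in>A. smooth_compatible c d) \<longrightarrow> c \<in> A)"

text \<open>
  The field \<open>mmetric\<close> holds the metric tensor in local coordinates: \<open>mmetric M c p v w\<close> is the
  inner product of the two tangent vectors at \<open>p\<close> with components \<open>v\<close> and \<open>w\<close> in the chart \<open>c\<close>.
  The field \<open>matlas\<close> is the maximal atlas, i.e. the set of all coordinate systems of \<open>M\<close>.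
\<close>

record ('m, 'e) manifold =
  mtop :: "'m topology"
  matlas :: "('m, 'e) chart set"
  mmetric :: "('m, 'e) chart \<Rightarrow> 'm \<Rightarrow> 'e \<Rightarrow> 'e \<Rightarrow> real"

definition riemannian_metric ::
  "('m, 'e::real_normed_vector) chart set \<Rightarrow> (('m, 'e) chart \<Rightarrow> 'm \<Rightarrow> 'e \<Rightarrow> 'e \<Rightarrow> real) \<Rightarrow> bool" where
  "riemannian_metric A g \<longleftrightarrow>
     (\<forall>c\<in>A. \<forall>p\<in>chart_dom c.
        bilinear (g c p) \<and> (\<forall>v w. g c p v w = g c p w v) \<and> (\<forall>v. v \<noteq> 0 \<longrightarrow> g c p v v > 0)) \<and>
     (\<forall>c\<in>A. \<forall>v w. smooth_on (chart_map c ` chart_dom c) (\<lambda>u. g c (chart_inv c u) v w)) \<and>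
     (\<forall>c\<in>A. \<forall>d\<in>A. \<forall>p\<in>chart_dom c \<inter> chart_dom d. \<forall>v w.
        g c p v w =
        g d p (frechet_derivative (chart_map d \<circ> chart_inv c) (at (chart_map c p)) v)
              (frechet_derivative (chart_map d \<circ> chart_inv c) (at (chart_map c p)) w))"

definition riemannian_manifold :: "('m, 'e::real_normed_vector) manifold \<Rightarrow> bool" where
  "riemannian_manifold M \<longleftrightarrow>
     Hausdorff_space (mtop M) \<and> second_countable (mtop M) \<and>
     maximal_smooth_atlas (mtop M) (matlas M) \<and>
     riemannian_metric (matlas M) (mmetric M)"

abbreviation mpoints :: "('m, 'e) manifold \<Rightarrow> 'm set" where
  "mpoints M \<equiv> topspace (mtop M)"

definition open_submanifold :: "('m, 'e) manifold \<Rightarrow> 'm set \<Rightarrow> ('m, 'e) manifold" where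
  "open_submanifold M U =
     \<lparr> mtop = subtopology (mtop M) U,
       matlas = {c \<in> matlas M. chart_dom c \<subseteq> U},
       mmetric = mmetric M \<rparr>"

definition smooth_map ::
  "('m, 'e::real_normed_vector) manifold \<Rightarrow> ('k, 'f::real_normed_vector) manifold \<Rightarrow> ('m \<Rightarrow> 'k) \<Rightarrow> bool"
  where
  "smooth_map M N \<phi> \<longleftrightarrow>
     continuous_map (mtop M) (mtop N) \<phi> \<and>
     (\<forall>c\<in>matlas M. \<forall>d\<in>matlas N.
        smooth_on (chart_map c ` (chart_dom c \<inter> \<phi> -` chart_dom d)) (chart_map d \<circ> \<phi> \<circ> chart_inv c))"

definition diffeomorphism ::
  "('m, 'e::real_normed_vector) manifold \<Rightarrow> ('k, 'f::real_normed_vector) manifold \<Rightarrow> ('m \<Rightarrow> 'k) \<Rightarrow> bool"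
  where
  "diffeomorphism M N \<phi> \<longleftrightarrow>
     bij_betw \<phi> (mpoints M) (mpoints N) \<and>
     smooth_map M N \<phi> \<and> smooth_map N M (inv_into (mpoints M) \<phi>)"


text \<open>The pullback at \<open>z\<close> of the metric of \<open>M\<close> along a smooth map \<open>f\<close> into \<open>M\<close> that is defined
  near \<open>z\<close>. It is computed in some chart around \<open>f z\<close>; by the transformation law of the metric
  the value does not depend on which one.\<close>

definition pullback_metric ::
  "('m, 'e::real_normed_vector) manifold \<Rightarrow> ('a::real_normed_vector \<Rightarrow> 'm) \<Rightarrow> 'a \<Rightarrow> 'a \<Rightarrow> 'a \<Rightarrow> real"
  where
  "pullback_metric M f z v w =
     (let c = (SOME c. c \<in> matlas M \<and> f z \<in> chart_dom c);
          D = frechet_derivative (chart_map c \<circ> f) (at z)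
      in mmetric M c (f z) (D v) (D w))"

definition conformal_forms :: "('a \<Rightarrow> 'a \<Rightarrow> real) \<Rightarrow> ('a \<Rightarrow> 'a \<Rightarrow> real) \<Rightarrow> bool" where
  "conformal_forms a b \<longleftrightarrow> (\<exists>r>0. \<forall>v w. a v w = r * b v w)"

definition slice :: "('m, complex \<times> 'q) chart \<Rightarrow> 'q \<Rightarrow> complex set" where
  "slice c q = {z. (z, q) \<in> chart_map c ` chart_dom c}"

definition slice_param :: "('m, complex \<times> 'q) chart \<Rightarrow> 'q \<Rightarrow> complex \<Rightarrow> 'm" where
  "slice_param c q z = chart_inv c (z, q)"

definition foliated_conformal_chart ::
  "('m, complex \<times> 'q::real_inner) manifold \<Rightarrow> ('m, complex \<times> 'q) chart \<Rightarrow> bool" where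
  "foliated_conformal_chart M \<psi> \<longleftrightarrow>
     \<psi> \<in> matlas M \<and>
     (\<forall>q. \<forall>z\<in>slice \<psi> q. conformal_forms (pullback_metric M (slice_param \<psi> q) z) inner)"


text \<open>
  A foliation is presented by a foliated atlas: charts with product images \<open>Z \<times> Q\<close>, \<open>Z\<close> connected,
  covering \<open>M\<close>, whose coordinate changes are locally of the form \<open>(z, q) \<mapsto> (f (z, q), \<gamma> q)\<close>.
  The plaques are the slices \<open>q = const\<close> of its charts, and the leaves are the classes of points
  that can be joined by chains of overlapping plaques. The slice parametrisations of the
  plaques are the local parametrisations of the leaves as immersed surfaces.
\<close>

definition foliated_atlas ::
  "('m, complex \<times> 'q::real_inner) manifold \<Rightarrow> ('m, complex \<times> 'q) chart set \<Rightarrow> bool" where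
  "foliated_atlas M C \<longleftrightarrow>
     C \<subseteq> matlas M \<and>
     (\<Union>c\<in>C. chart_dom c) = mpoints M \<and>
     (\<forall>c\<in>C. \<exists>Z Q. connected Z \<and> chart_map c ` chart_dom c = Z \<times> Q) \<and>
     (\<forall>c\<in>C. \<forall>d\<in>C. \<forall>p\<in>chart_dom c \<inter> chart_dom d.
        \<exists>W. openin (mtop M) W \<and> p \<in> W \<and> W \<subseteq> chart_dom c \<inter> chart_dom d \<and>
            (\<forall>x\<in>W. \<forall>y\<in>W. snd (chart_map c x) = snd (chart_map c y) \<longrightarrow>
                           snd (chart_map d x) = snd (chart_map d y)))"

definition same_plaque :: "('m, complex \<times> 'q) chart set \<Rightarrow> ('m \<times> 'm) set" where
  "same_plaque C =
     {(x, y). \<exists>c\<in>C. x \<in> chart_dom c \<and> y \<in> chart_dom c \<and> snd (chart_map c x) = snd (chart_map c y)}"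

definition foliation_leaves ::
  "('m, complex \<times> 'q) manifold \<Rightarrow> ('m, complex \<times> 'q) chart set \<Rightarrow> 'm set set" where
  "foliation_leaves M C = mpoints M // (same_plaque C)\<^sup>+"

text \<open>Conformality of \<open>\<phi> : L \<rightarrow> \<phi>(L)\<close> for the induced metrics, expressed in the local
  parametrisations \<open>j\<close> of \<open>L\<close> and \<open>\<phi> \<circ> j\<close> of \<open>\<phi>(L)\<close>.\<close>

definition conformal_on_leaf ::
  "('m, complex \<times> 'q::real_inner) manifold \<Rightarrow> ('k, complex \<times> 'q) manifold \<Rightarrow> ('m \<Rightarrow> 'k) \<Rightarrow>
   ('m, complex \<times> 'q) chart set \<Rightarrow> 'm set \<Rightarrow> bool" where
  "conformal_on_leaf M N \<phi> C L \<longleftrightarrow>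
     (\<forall>c\<in>C. \<forall>p\<in>L \<inter> chart_dom c.
        let z = fst (chart_map c p); j = slice_param c (snd (chart_map c p))
        in conformal_forms (pullback_metric N (\<phi> \<circ> j) z) (pullback_metric M j z))"

definition leafwise_conformal ::
  "('m, complex \<times> 'q::real_inner) manifold \<Rightarrow> ('k, complex \<times> 'q) manifold \<Rightarrow> ('m \<Rightarrow> 'k) \<Rightarrow> bool" where
  "leafwise_conformal M N \<phi> \<longleftrightarrow>
     diffeomorphism M N \<phi> \<and>
     (\<exists>C. foliated_atlas M C \<and> (\<forall>L\<in>foliation_leaves M C. conformal_on_leaf M N \<phi> C L))"

definition locally_leafwise_conformal ::
  "('m, complex \<times> 'q::real_inner) manifold \<Rightarrow> ('k, complex \<times> 'q) manifold \<Rightarrow> ('m \<Rightarrow> 'k) \<Rightarrow> bool" where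
  "locally_leafwise_conformal M N \<phi> \<longleftrightarrow>
     (\<forall>x\<in>mpoints M. \<exists>U. openin (mtop M) U \<and> x \<in> U \<and>
        leafwise_conformal (open_submanifold M U) (open_submanifold N (\<phi> ` U)) \<phi>)"

end

theory Submission
  imports Defs "HOL-Complex_Analysis.Conformal_Mappings"
begin

text \<open>
  Near \<open>x\<close>, restrict \<open>\<psi>\<close> to a set \<open>U\<close> whose image is a box \<open>Z \<times> Q\<close>; this one chart is a foliated
  atlas of \<open>U\<close>. Along a slice, the metric of \<open>M\<close> pulls back to \<open>r \<cdot> inner\<close>, while \<open>\<phi>\<close> followed
  by \<open>\<psi>'\<close> has derivative \<open>v \<mapsto> (h' v, 0)\<close>, so the metric of \<open>N\<close> pulls back to
  \<open>s \<bar>h'\<bar>\<^sup>2 \<cdot> inner\<close>. Since \<open>\<phi>\<close> is injective, \<open>z \<mapsto> h (z, q)\<close> is an injective holomorphic map, hence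
  \<open>h' \<noteq> 0\<close> and the two forms are proportional with a positive factor.
\<close>

section \<open>Local changes of differentiable and smooth maps\<close>

lemma has_derivative_transform_nhds:
  assumes "(f has_derivative D) (at z)" "\<forall>\<^sub>F w in nhds z. f w = g w"
  shows "(g has_derivative D) (at z)"
proof -
  obtain S where "open S" "z \<in> S" "\<And>w. w \<in> S \<Longrightarrow> f w = g w"
    using assms(2) unfolding eventually_nhds by blast
  then show ?thesis
    using has_derivative_transform_within_open[OF assms(1)] by blast
qed

text \<open>On an open set a derivative depends only on the values taken there, so agreement of the
  two maps passes to their directional derivatives. The induction therefore generalises over both
  maps.\<close>

lemma Ck_on_cong_subset:
  assumes "open T" "T \<subseteq> S" "\<And>x. x \<in> T \<Longrightarrow> f x = g x" "Ck_on k S f"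
  shows "Ck_on k T g"
  using assms(3,4)
proof (induction k arbitrary: f g)
  case 0
  then show ?case
    using continuous_on_subset[OF _ assms(2), of f] continuous_on_cong[OF refl, of T f g] by simp
next
  case (Suc k)
  have der: "(g has_derivative frechet_derivative f (at x)) (at x)" if "x \<in> T" for x
  proof (rule has_derivative_transform_within_open)
    show "(f has_derivative frechet_derivative f (at x)) (at x)"
      using Suc.prems(2) that assms(2) by (auto simp: frechet_derivative_works)
  qed (use that assms(1) Suc.prems(1) in auto)
  have "frechet_derivative f (at x) v = frechet_derivative g (at x) v" if "x \<in> T" for x v
    using frechet_derivative_at[OF der[OF that]] by simp
  then have "Ck_on k T (\<lambda>x. frechet_derivative g (at x) v)" for v
    using Suc.IH[of "\<lambda>x. frechet_derivative f (at x) v"] Suc.prems(2) by simp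
  then show ?case
    using der by (auto simp: differentiable_def)
qed

lemma smooth_on_cong_subset:
  assumes "open T" "T \<subseteq> S" "\<And>x. x \<in> T \<Longrightarrow> f x = g x" "smooth_on S f"
  shows "smooth_on T g"
  unfolding smooth_on_def
proof
  show "Ck_on k T g" for k
    by (rule Ck_on_cong_subset[OF assms(1,2,3)]) (use assms(4) in \<open>simp_all add: smooth_on_def\<close>)
qed

lemma smooth_on_differentiable:
  assumes "smooth_on S f" "x \<in> S"
  shows "f differentiable (at x)"
proof -
  have "Ck_on (Suc 0) S f"
    using assms(1) unfolding smooth_on_def by blast
  then show ?thesis
    using assms(2) by simp
qed

section \<open>Charts and their restriction to open sets\<close>

lemma topological_chart_inj_on:
  assumes "topological_chart X c"
  shows "inj_on (chart_map c) (chart_dom c)"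
proof -
  have "topspace X \<inter> chart_dom c = chart_dom c"
    using assms openin_subset unfolding topological_chart_def by blast
  then show ?thesis
    using assms homeomorphic_imp_injective_map unfolding topological_chart_def by fastforce
qed

lemma chart_inv_chart_map:
  "topological_chart X c \<Longrightarrow> p \<in> chart_dom c \<Longrightarrow> chart_inv c (chart_map c p) = p"
  unfolding chart_inv_def by (simp add: topological_chart_inj_on)

lemma topological_chart_open_image:
  assumes c: "topological_chart X c" and W: "openin X W"
  shows "open (chart_map c ` (chart_dom c \<inter> W))"
proof -
  have "openin (subtopology X (chart_dom c)) (chart_dom c \<inter> W)"
    using W by (auto simp: openin_subtopology)
  moreover have "open_map (subtopology X (chart_dom c))
      (top_of_set (chart_map c ` chart_dom c)) (chart_map c)"
    using c homeomorphic_imp_open_map unfolding topological_chart_def by blast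
  ultimately have "openin (top_of_set (chart_map c ` chart_dom c)) (chart_map c ` (chart_dom c \<inter> W))"
    unfolding open_map_def by blast
  then show ?thesis
    using c openin_open_trans unfolding topological_chart_def by blast
qed

lemma topological_chart_open_vimage:
  assumes c: "topological_chart X c" and V: "open V"
  shows "openin X (chart_dom c \<inter> chart_map c -` V)"
proof -
  have dom: "openin X (chart_dom c)"
    using c unfolding topological_chart_def by blast
  have "continuous_map (subtopology X (chart_dom c)) euclidean (chart_map c)"
    using c homeomorphic_imp_continuous_map continuous_map_in_subtopology
    unfolding topological_chart_def by blast
  then have "openin (subtopology X (chart_dom c))
      {p \<in> topspace (subtopology X (chart_dom c)). chart_map c p \<in> V}"
    using V openin_continuous_map_preimage open_openin by blast
  moreover have "{p \<in> topspace (subtopology X (chart_dom c)). chart_map c p \<in> V}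
      = chart_dom c \<inter> chart_map c -` V"
    using openin_subset[OF dom] by auto
  ultimately show ?thesis
    using dom openin_trans_full by metis
qed

lemma topological_chart_restrict:
  assumes c: "topological_chart X c" and U: "openin X U"
  shows "topological_chart X (chart_dom c \<inter> U, chart_map c)"
proof -
  have "homeomorphic_map (subtopology (subtopology X (chart_dom c)) U)
     (subtopology (top_of_set (chart_map c ` chart_dom c)) (chart_map c ` (chart_dom c \<inter> U)))
     (chart_map c)"
  proof (rule homeomorphic_map_subtopologies)
    have "topspace X \<inter> chart_dom c = chart_dom c"
      using c openin_subset unfolding topological_chart_def by blast
    then show "chart_map c ` (topspace (subtopology X (chart_dom c)) \<inter> U) =
        topspace (top_of_set (chart_map c ` chart_dom c)) \<inter> chart_map c ` (chart_dom c \<inter> U)"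
      by auto
  qed (use c in \<open>auto simp: topological_chart_def\<close>)
  moreover have "chart_map c ` chart_dom c \<inter> chart_map c ` (chart_dom c \<inter> U)
      = chart_map c ` (chart_dom c \<inter> U)"
    by blast
  ultimately show ?thesis
    using topological_chart_open_image[OF c U] c U
    unfolding topological_chart_def by (simp add: subtopology_subtopology openin_Int)
qed

text \<open>Maximality reduces membership to compatibility with each chart of \<open>A\<close>, and
  the transition maps are restrictions of those of \<open>c\<close>. Restricted charts are what
  provide foliated atlases and charts of open submanifolds.\<close>

lemma maximal_smooth_atlas_restrict:
  assumes A: "maximal_smooth_atlas X A" and cA: "c \<in> A" and U: "openin X U"
  shows "(chart_dom c \<inter> U, chart_map c) \<in> A"
proof -
  have top: "topological_chart X d" if "d \<in> A" for d
    using A that unfolding maximal_smooth_atlas_def by blast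
  have dom: "openin X (chart_dom d)" if "d \<in> A" for d
    using top[OF that] unfolding topological_chart_def by blast
  let ?r = "(chart_dom c \<inter> U, chart_map c)"
  have r: "topological_chart X ?r"
    by (rule topological_chart_restrict[OF top[OF cA] U])
  have "smooth_compatible ?r d" if d: "d \<in> A" for d
  proof -
    have cd: "smooth_compatible c d"
      using A cA d unfolding maximal_smooth_atlas_def by blast
    \<comment> \<open>\<open>chart_inv\<close> is an \<open>inv_into\<close> over the chart domain,
      so shrinking the domain changes the inverse as a total function; the two inverses agree only
      on the smaller image.\<close>
    have eq: "chart_inv c (chart_map c p) = chart_inv ?r (chart_map c p)"
      if "p \<in> chart_dom c \<inter> U" for p
      using chart_inv_chart_map[OF top[OF cA], of p] chart_inv_chart_map[OF r, of p] that by auto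
    have "open (chart_map c ` (chart_dom ?r \<inter> chart_dom d))"
      using topological_chart_open_image[OF r dom[OF d]] by simp
    then have 1: "smooth_on (chart_map c ` (chart_dom ?r \<inter> chart_dom d)) (chart_map d \<circ> chart_inv ?r)"
      by (rule smooth_on_cong_subset[where S = "chart_map c ` (chart_dom c \<inter> chart_dom d)"
            and f = "chart_map d \<circ> chart_inv c"])
        (use cd eq in \<open>auto simp: smooth_compatible_def\<close>)
    have "open (chart_map d ` (chart_dom d \<inter> (chart_dom c \<inter> U)))"
      by (rule topological_chart_open_image[OF top[OF d] openin_Int[OF dom[OF cA] U]])
    then have "open (chart_map d ` (chart_dom ?r \<inter> chart_dom d))"
      by (simp add: Int_commute)
    then have "smooth_on (chart_map d ` (chart_dom ?r \<inter> chart_dom d)) (chart_map c \<circ> chart_inv d)"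
      by (rule smooth_on_cong_subset[where S = "chart_map d ` (chart_dom c \<inter> chart_dom d)"
            and f = "chart_map c \<circ> chart_inv d"])
        (use cd in \<open>auto simp: smooth_compatible_def\<close>)
    with 1 show ?thesis
      unfolding smooth_compatible_def by simp
  qed
  with A r show ?thesis
    unfolding maximal_smooth_atlas_def by blast
qed

lemma manifold_chart:
  assumes "riemannian_manifold M" "c \<in> matlas M"
  shows "topological_chart (mtop M) c" "openin (mtop M) (chart_dom c)"
  using assms unfolding riemannian_manifold_def maximal_smooth_atlas_def topological_chart_def
  by blast+

lemma manifold_chart_restrict:
  assumes "riemannian_manifold M" "c \<in> matlas M" "openin (mtop M) U"
  shows "(chart_dom c \<inter> U, chart_map c) \<in> matlas M"
  using assms maximal_smooth_atlas_restrict unfolding riemannian_manifold_def by blast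

section \<open>Pulling back a metric in coordinates\<close>

text \<open>The chain rule factors the derivative of \<open>f\<close> read in \<open>c\<close>
  through the transition map from \<open>d\<close> to \<open>c\<close>, and the transformation law
  of the metric absorbs that map. This frees \<open>pullback_metric\<close> from the chart picked by
  its \<open>SOME\<close>.\<close>

lemma metric_pullback_chart_independent:
  assumes M: "riemannian_manifold M" and c: "c \<in> matlas M" and d: "d \<in> matlas M"
    and fc: "f z \<in> chart_dom c" and fd: "\<forall>\<^sub>F w in nhds z. f w \<in> chart_dom d"
    and D: "((chart_map d \<circ> f) has_derivative D) (at z)"
  shows "mmetric M c (f z) (frechet_derivative (chart_map c \<circ> f) (at z) v)
             (frechet_derivative (chart_map c \<circ> f) (at z) w) = mmetric M d (f z) (D v) (D w)"
proof -
  have fzd: "f z \<in> chart_dom d"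
    using fd eventually_nhds_x_imp_x by blast
  let ?V = "chart_map d ` (chart_dom d \<inter> chart_dom c)"
  have V: "open ?V"
    by (rule topological_chart_open_image[OF manifold_chart(1)[OF M d] manifold_chart(2)[OF M c]])
  \<comment> \<open>Differentiability makes the coordinate expression continuous at
    \<open>z\<close>, so it stays in the open set \<open>?V\<close> nearby. Since
    \<open>chart_map d\<close> is injective, \<open>f w\<close> itself then lies in both chart
    domains.\<close>
  have "((chart_map d \<circ> f) \<longlongrightarrow> (chart_map d \<circ> f) z) (nhds z)"
    using has_derivative_continuous[OF D] continuous_at by (metis tendsto_at_iff_tendsto_nhds)
  then have "\<forall>\<^sub>F w in nhds z. (chart_map d \<circ> f) w \<in> ?V"
    by (rule topological_tendstoD[OF _ V]) (use fc fzd in auto)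
  then have near: "\<forall>\<^sub>F w in nhds z. f w \<in> chart_dom c \<inter> chart_dom d"
    using fd
  proof eventually_elim
    case (elim w)
    then show ?case
      using topological_chart_inj_on[OF manifold_chart(1)[OF M d]] by (auto dest: inj_onD)
  qed
  let ?S = "chart_map c \<circ> chart_inv d"
  have "smooth_compatible d c"
    using M c d unfolding riemannian_manifold_def maximal_smooth_atlas_def by blast
  then have S: "(?S has_derivative frechet_derivative ?S (at (chart_map d (f z))))
      (at (chart_map d (f z)))"
    using smooth_on_differentiable[of _ ?S "chart_map d (f z)"] fc fzd
    unfolding smooth_compatible_def frechet_derivative_works[symmetric] by auto
  let ?E = "frechet_derivative ?S (at (chart_map d (f z)))"
  have "((?S \<circ> (chart_map d \<circ> f)) has_derivative (?E \<circ> D)) (at z)"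
    using S by (intro diff_chain_at[OF D]) simp
  moreover have "\<forall>\<^sub>F w in nhds z. (?S \<circ> (chart_map d \<circ> f)) w = (chart_map c \<circ> f) w"
    using near by eventually_elim (use chart_inv_chart_map[OF manifold_chart(1)[OF M d]] in auto)
  ultimately have "((chart_map c \<circ> f) has_derivative (?E \<circ> D)) (at z)"
    by (rule has_derivative_transform_nhds)
  then have "frechet_derivative (chart_map c \<circ> f) (at z) = ?E \<circ> D"
    using frechet_derivative_at by metis
  moreover have "mmetric M d (f z) (D v) (D w) = mmetric M c (f z) (?E (D v)) (?E (D w))"
    using M c d fc fzd unfolding riemannian_manifold_def riemannian_metric_def by blast
  ultimately show ?thesis
    by simp
qed

lemma pullback_metric_eq:
  assumes "riemannian_manifold M" "d \<in> matlas M" "\<forall>\<^sub>F w in nhds z. f w \<in> chart_dom d"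
    and "((chart_map d \<circ> f) has_derivative D) (at z)"
  shows "pullback_metric M f z v w = mmetric M d (f z) (D v) (D w)"
proof -
  have "d \<in> matlas M \<and> f z \<in> chart_dom d"
    using assms eventually_nhds_x_imp_x by blast
  then show ?thesis
    using someI[of "\<lambda>c. c \<in> matlas M \<and> f z \<in> chart_dom c" d] assms
    unfolding pullback_metric_def Let_def by (intro metric_pullback_chart_independent) auto
qed

text \<open>The \<open>SOME\<close> now ranges over the charts inside \<open>U\<close> and may pick
  another chart than it does for \<open>M\<close>. Whatever it picks is still a chart of
  \<open>M\<close>, with the same metric, so chart independence in \<open>M\<close> applies;
  \<open>d\<close> may extend beyond \<open>U\<close>.\<close>

lemma pullback_metric_open_submanifold_eq:
  assumes M: "riemannian_manifold M" and d: "d \<in> matlas M"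
    and fd: "\<forall>\<^sub>F w in nhds z. f w \<in> chart_dom d"
    and D: "((chart_map d \<circ> f) has_derivative D) (at z)"
    and U: "openin (mtop M) U" "f z \<in> U"
  shows "pullback_metric (open_submanifold M U) f z v w = mmetric M d (f z) (D v) (D w)"
proof -
  define P where "P c \<longleftrightarrow> c \<in> matlas (open_submanifold M U) \<and> f z \<in> chart_dom c" for c
  \<comment> \<open>Restricting \<open>d\<close> to \<open>U\<close> shows that the choice ranges
    over a nonempty set of charts.\<close>
  have "P (chart_dom d \<inter> U, chart_map d)"
    using eventually_nhds_x_imp_x[OF fd] manifold_chart_restrict[OF M d U(1)] U(2)
    by (simp add: P_def open_submanifold_def)
  then have "P (Eps P)"
    by (rule someI)
  then have c: "Eps P \<in> matlas M" "f z \<in> chart_dom (Eps P)"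
    by (simp_all add: P_def open_submanifold_def)
  have "pullback_metric (open_submanifold M U) f z v w =
      mmetric M (Eps P) (f z) (frechet_derivative (chart_map (Eps P) \<circ> f) (at z) v)
        (frechet_derivative (chart_map (Eps P) \<circ> f) (at z) w)"
    unfolding pullback_metric_def Let_def P_def by (simp add: open_submanifold_def)
  then show ?thesis
    using metric_pullback_chart_independent[OF M c(1) d c(2) fd D] by simp
qed

section \<open>Restricting a diffeomorphism to an open set\<close>

lemma diffeomorphism_image_open:
  assumes "diffeomorphism M N \<phi>" "openin (mtop M) U"
  shows "openin (mtop N) (\<phi> ` U)"
proof -
  let ?i = "inv_into (mpoints M) \<phi>"
  have bij: "bij_betw \<phi> (mpoints M) (mpoints N)" and i: "continuous_map (mtop N) (mtop M) ?i"
    using assms(1) unfolding diffeomorphism_def smooth_map_def by auto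
  have "U \<subseteq> mpoints M"
    by (rule openin_subset[OF assms(2)])
  \<comment> \<open>The image is the preimage of \<open>U\<close> under the continuous
    inverse.\<close>
  have "\<phi> ` U = {y \<in> mpoints N. ?i y \<in> U}"
  proof safe
    fix x assume "x \<in> U"
    then show "\<phi> x \<in> mpoints N" "?i (\<phi> x) \<in> U"
      using \<open>U \<subseteq> mpoints M\<close> bij by (auto simp: bij_betw_def)
  next
    fix y assume "y \<in> mpoints N" "?i y \<in> U"
    then show "y \<in> \<phi> ` U"
      using bij by (metis bij_betw_inv_into_right imageI)
  qed
  then show ?thesis
    using openin_continuous_map_preimage[OF i assms(2)] by simp
qed

text \<open>Charts of the open submanifolds are charts of \<open>M\<close> and \<open>N\<close>, so
  smoothness of \<phi> is inherited directly. The work lies in the inverse: \<open>?j\<close>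
  inverts \<phi> over \<open>U\<close> and \<open>?i\<close> over all of \<open>M\<close>, and they
  are known to agree only on the image of \<open>U\<close>.\<close>

lemma diffeomorphism_open_submanifold:
  assumes M: "riemannian_manifold M" and N: "riemannian_manifold N"
    and \<phi>: "diffeomorphism M N \<phi>" and U: "openin (mtop M) U"
  shows "diffeomorphism (open_submanifold M U) (open_submanifold N (\<phi> ` U)) \<phi>"
proof -
  let ?M = "open_submanifold M U" and ?N = "open_submanifold N (\<phi> ` U)"
  let ?i = "inv_into (mpoints M) \<phi>" and ?j = "inv_into (mpoints ?M) \<phi>"
  have bij: "bij_betw \<phi> (mpoints M) (mpoints N)"
    and smooth: "smooth_map M N \<phi>" "smooth_map N M ?i"
    using \<phi> unfolding diffeomorphism_def by auto
  have UM: "U \<subseteq> mpoints M"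
    by (rule openin_subset[OF U])
  have \<phi>U: "\<phi> ` U \<subseteq> mpoints N"
    by (rule openin_subset[OF diffeomorphism_image_open[OF \<phi> U]])
  have top: "mpoints ?M = U" "mpoints ?N = \<phi> ` U"
    using UM \<phi>U by (auto simp: open_submanifold_def)
  have inj: "inj_on \<phi> (mpoints M)"
    using bij by (simp add: bij_betw_def)
  have ij: "?i y = ?j y" if "y \<in> \<phi> ` U" for y
  proof -
    from that obtain x where x: "x \<in> U" "y = \<phi> x"
      by blast
    show ?thesis
      unfolding top x(2) using inv_into_f_f[OF inj subsetD[OF UM x(1)]]
        inv_into_f_f[OF inj_on_subset[OF inj UM] x(1)] by simp
  qed
  have jU: "?j y \<in> U" if "y \<in> \<phi> ` U" for y
    using that by (simp add: top inv_into_into)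
  have "bij_betw \<phi> (mpoints ?M) (mpoints ?N)"
    using inj_on_subset[OF inj UM] by (simp add: top bij_betw_def)
  moreover have "smooth_map ?M ?N \<phi>"
    unfolding smooth_map_def
  proof (intro conjI ballI)
    have "continuous_map (subtopology (mtop M) U) (mtop N) \<phi>"
      using smooth(1) continuous_map_from_subtopology unfolding smooth_map_def by blast
    then show "continuous_map (mtop ?M) (mtop ?N) \<phi>"
      by (simp add: open_submanifold_def continuous_map_in_subtopology image_mono)
  next
    fix c d assume "c \<in> matlas ?M" "d \<in> matlas ?N"
    then have "c \<in> matlas M" "d \<in> matlas N"
      by (simp_all add: open_submanifold_def)
    then show "smooth_on (chart_map c ` (chart_dom c \<inter> \<phi> -` chart_dom d)) (chart_map d \<circ> \<phi> \<circ> chart_inv c)"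
      using smooth(1) unfolding smooth_map_def by blast
  qed
  moreover have "smooth_map ?N ?M ?j"
    unfolding smooth_map_def
  proof (intro conjI ballI)
    have "continuous_map (subtopology (mtop N) (\<phi> ` U)) (mtop M) ?i"
      using smooth(2) continuous_map_from_subtopology unfolding smooth_map_def by blast
    then have "continuous_map (subtopology (mtop N) (\<phi> ` U)) (mtop M) ?j"
      by (rule continuous_map_eq) (use ij in auto)
    then show "continuous_map (mtop ?N) (mtop ?M) ?j"
      using jU by (auto simp: open_submanifold_def continuous_map_in_subtopology)
  next
    fix c d assume "c \<in> matlas ?N" "d \<in> matlas ?M"
    then have c: "c \<in> matlas N" "chart_dom c \<subseteq> \<phi> ` U" and d: "d \<in> matlas M"
      by (auto simp: open_submanifold_def)
    have same: "chart_dom c \<inter> ?j -` chart_dom d = chart_dom c \<inter> ?i -` chart_dom d"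
      using c(2) ij by auto
    \<comment> \<open>Replacing \<open>?i\<close> by \<open>?j\<close> inside
      \<open>smooth_on\<close> requires an open coordinate set; openness comes from continuity of
      \<open>?i\<close>.\<close>
    have "openin (mtop N) {y \<in> mpoints N. ?i y \<in> chart_dom d}"
      using smooth(2) openin_continuous_map_preimage manifold_chart(2)[OF M d]
      unfolding smooth_map_def by blast
    from topological_chart_open_image[OF manifold_chart(1)[OF N c(1)] this]
    have "open (chart_map c ` (chart_dom c \<inter> {y \<in> mpoints N. ?i y \<in> chart_dom d}))" .
    also have "chart_dom c \<inter> {y \<in> mpoints N. ?i y \<in> chart_dom d} = chart_dom c \<inter> ?j -` chart_dom d"
      using same c(2) \<phi>U by auto
    finally show "smooth_on (chart_map c ` (chart_dom c \<inter> ?j -` chart_dom d))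
        (chart_map d \<circ> ?j \<circ> chart_inv c)"
    proof (rule smooth_on_cong_subset)
      show "smooth_on (chart_map c ` (chart_dom c \<inter> ?i -` chart_dom d))
          (chart_map d \<circ> ?i \<circ> chart_inv c)"
        using smooth(2) c(1) d unfolding smooth_map_def by blast
    next
      fix u assume "u \<in> chart_map c ` (chart_dom c \<inter> ?j -` chart_dom d)"
      then have "chart_inv c u \<in> \<phi> ` U"
        using chart_inv_chart_map[OF manifold_chart(1)[OF N c(1)]] c(2) by auto
      then show "(chart_map d \<circ> ?i \<circ> chart_inv c) u = (chart_map d \<circ> ?j \<circ> chart_inv c) u"
        by (simp add: ij)
    qed (simp add: same)
  qed
  ultimately show ?thesis
    unfolding diffeomorphism_def by blast
qed

section \<open>Conformality along slices\<close>

text \<open>Read in \<psi>, a slice parametrisation is \<open>w \<mapsto> (w, q)\<close>, with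
  derivative \<open>v \<mapsto> (v, 0)\<close>. Conformality of the slices thus becomes a condition
  on the metric coefficients for vectors tangent to the first factor.\<close>

lemma foliated_conformal_chart_metric:
  assumes M: "riemannian_manifold M" and \<psi>: "foliated_conformal_chart M \<psi>"
    and p: "p \<in> chart_dom \<psi>"
  shows "\<exists>r>0. \<forall>v w. mmetric M \<psi> p (v, 0) (w, 0) = r * inner v w"
proof -
  have \<psi>M: "\<psi> \<in> matlas M"
    using \<psi> unfolding foliated_conformal_chart_def by blast
  note top = manifold_chart(1)[OF M \<psi>M]
  obtain z q where zq: "chart_map \<psi> p = (z, q)"
    by fastforce
  have sp: "slice_param \<psi> q z = p"
    using chart_inv_chart_map[OF top p] zq by (simp add: slice_param_def)
  have zs: "z \<in> slice \<psi> q"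
    using p zq unfolding slice_def by force
  have "open ((\<lambda>w. (w, q)) -` (chart_map \<psi> ` chart_dom \<psi>))"
    using top by (intro open_vimage continuous_intros) (auto simp: topological_chart_def)
  then have near: "\<forall>\<^sub>F w in nhds z. (w, q) \<in> chart_map \<psi> ` chart_dom \<psi>"
    by (rule eventually_nhds_in_open[of "(\<lambda>w. (w, q)) -` _" z, unfolded vimage_eq])
      (use zs in \<open>simp add: slice_def\<close>)
  have dom: "\<forall>\<^sub>F w in nhds z. slice_param \<psi> q w \<in> chart_dom \<psi>"
    using near by eventually_elim (simp add: slice_param_def chart_inv_def inv_into_into)
  have val: "\<forall>\<^sub>F w in nhds z. (w, q) = (chart_map \<psi> \<circ> slice_param \<psi> q) w"
    using near by eventually_elim (simp add: slice_param_def chart_inv_def f_inv_into_f)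
  have "((\<lambda>w. (w, q)) has_derivative (\<lambda>v. (v, 0))) (at z)"
    by (auto intro!: derivative_eq_intros)
  then have "((chart_map \<psi> \<circ> slice_param \<psi> q) has_derivative (\<lambda>v. (v, 0))) (at z)"
    using val has_derivative_transform_nhds by blast
  then have "pullback_metric M (slice_param \<psi> q) z v w = mmetric M \<psi> p (v, 0) (w, 0)" for v w
    using pullback_metric_eq[OF M \<psi>M dom] sp by simp
  then show ?thesis
    using \<psi> zs unfolding foliated_conformal_chart_def conformal_forms_def by metis
qed

section \<open>Leafwise conformality of \<phi> near a point\<close>

theorem theorem6p1:
  fixes M :: "('m, complex \<times> 'q::findim_inner) manifold"
    and N :: "('k, complex \<times> 'q) manifold"
    and \<phi> :: "'m \<Rightarrow> 'k"
  assumes "riemannian_manifold M" and "riemannian_manifold N"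
    and "diffeomorphism M N \<phi>"
    and "\<And>x. x \<in> mpoints M \<Longrightarrow>
      \<exists>\<psi> \<psi>'. foliated_conformal_chart M \<psi> \<and> x \<in> chart_dom \<psi> \<and>
             foliated_conformal_chart N \<psi>' \<and> \<phi> x \<in> chart_dom \<psi>' \<and>
             (\<exists>h :: complex \<times> 'q \<Rightarrow> complex.
                let D = chart_map \<psi> ` (chart_dom \<psi> \<inter> \<phi> -` chart_dom \<psi>') in
                (\<forall>(z, q)\<in>D. (chart_map \<psi>' \<circ> \<phi> \<circ> chart_inv \<psi>) (z, q) = (h (z, q), q)) \<and>
                (\<forall>q. (\<lambda>z. h (z, q)) holomorphic_on {z. (z, q) \<in> D}))"
  shows "locally_leafwise_conformal M N \<phi>"
  unfolding locally_leafwise_conformal_def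
proof
  note M = assms(1) and N = assms(2) and \<phi> = assms(3)
  fix x assume x: "x \<in> mpoints M"
  obtain \<psi> \<psi>' h where
    \<psi>: "foliated_conformal_chart M \<psi>" "x \<in> chart_dom \<psi>" and
    \<psi>': "foliated_conformal_chart N \<psi>'" "\<phi> x \<in> chart_dom \<psi>'" and
    h': "\<forall>(z, q) \<in> chart_map \<psi> ` (chart_dom \<psi> \<inter> \<phi> -` chart_dom \<psi>').
          (chart_map \<psi>' \<circ> \<phi> \<circ> chart_inv \<psi>) (z, q) = (h (z, q), q)" and
    hol: "\<forall>q. (\<lambda>z. h (z, q)) holomorphic_on
          {z. (z, q) \<in> chart_map \<psi> ` (chart_dom \<psi> \<inter> \<phi> -` chart_dom \<psi>')}"
    using assms(4)[OF x, unfolded Let_def] by (elim exE conjE) (rule that)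
  define D where "D = chart_map \<psi> ` (chart_dom \<psi> \<inter> \<phi> -` chart_dom \<psi>')"
  have h: "chart_map \<psi>' (\<phi> (chart_inv \<psi> (z, q))) = (h (z, q), q)" if "(z, q) \<in> D" for z q
    using bspec[OF h', of "(z, q)"] that by (simp add: D_def)
  have \<psi>M: "\<psi> \<in> matlas M" and \<psi>'N: "\<psi>' \<in> matlas N"
    using \<psi>(1) \<psi>'(1) unfolding foliated_conformal_chart_def by auto
  note top\<psi> = manifold_chart[OF M \<psi>M] and top\<psi>' = manifold_chart[OF N \<psi>'N]
  have inj\<phi>: "inj_on \<phi> (mpoints M)" and cont\<phi>: "continuous_map (mtop M) (mtop N) \<phi>"
    using \<phi> unfolding diffeomorphism_def smooth_map_def by (auto simp: bij_betw_def)
  have dom\<psi>: "chart_dom \<psi> \<subseteq> mpoints M"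
    by (rule openin_subset[OF top\<psi>(2)])
  have "openin (mtop M) {y \<in> mpoints M. \<phi> y \<in> chart_dom \<psi>'}"
    by (rule openin_continuous_map_preimage[OF cont\<phi> top\<psi>'(2)])
  from topological_chart_open_image[OF top\<psi>(1) this]
  have "open (chart_map \<psi> ` (chart_dom \<psi> \<inter> {y \<in> mpoints M. \<phi> y \<in> chart_dom \<psi>'}))" .
  also have "chart_dom \<psi> \<inter> {y \<in> mpoints M. \<phi> y \<in> chart_dom \<psi>'} = chart_dom \<psi> \<inter> \<phi> -` chart_dom \<psi>'"
    using dom\<psi> by auto
  finally have openD: "open D"
    by (simp add: D_def)
  have D_inv: "chart_inv \<psi> u \<in> chart_dom \<psi>" "\<phi> (chart_inv \<psi> u) \<in> chart_dom \<psi>'"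
      "chart_map \<psi> (chart_inv \<psi> u) = u" if "u \<in> D" for u
    using that chart_inv_chart_map[OF top\<psi>(1)] by (auto simp: D_def)
  have xD: "chart_map \<psi> x \<in> D"
    using \<psi>(2) \<psi>'(2) by (auto simp: D_def)
  then obtain Z0 Q where Z0: "open Z0" and Q: "open Q" and x0: "chart_map \<psi> x \<in> Z0 \<times> Q"
    and Z0Q: "Z0 \<times> Q \<subseteq> D"
    using open_prod_elim[OF openD] by metis
  \<comment> \<open>A ball is taken inside \<open>Z0\<close> because the first factor of a foliated
    chart must be connected.\<close>
  obtain e where e: "e > 0" "ball (fst (chart_map \<psi> x)) e \<subseteq> Z0"
    using Z0 x0 open_contains_ball by (metis mem_Times_iff)
  define Z where "Z = ball (fst (chart_map \<psi> x)) e"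
  have Z: "open Z" "connected Z" and xZQ: "chart_map \<psi> x \<in> Z \<times> Q" and ZQ: "Z \<times> Q \<subseteq> D"
    using e x0 Z0Q by (auto simp: Z_def mem_Times_iff)
  define U where "U = chart_dom \<psi> \<inter> chart_map \<psi> -` (Z \<times> Q)"
  have U: "openin (mtop M) U"
    unfolding U_def using Z(1) Q by (intro topological_chart_open_vimage[OF top\<psi>(1)] open_Times)
  have U\<psi>: "U \<subseteq> chart_dom \<psi>"
    by (simp add: U_def)
  have xU: "x \<in> U"
    using xZQ \<psi>(2) by (simp add: U_def)
  have imU: "chart_map \<psi> ` U = Z \<times> Q"
  proof
    show "chart_map \<psi> ` U \<subseteq> Z \<times> Q"
      by (auto simp: U_def)
    show "Z \<times> Q \<subseteq> chart_map \<psi> ` U"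
    proof
      fix u assume u: "u \<in> Z \<times> Q"
      then have "u \<in> D"
        using ZQ by blast
      then have "chart_inv \<psi> u \<in> U"
        using D_inv u by (simp add: U_def)
      then show "u \<in> chart_map \<psi> ` U"
        using D_inv(3)[OF \<open>u \<in> D\<close>] by (metis imageI)
    qed
  qed
  define c where "c = (U, chart_map \<psi>)"
  have cM: "c \<in> matlas M"
    using manifold_chart_restrict[OF M \<psi>M U] U\<psi> by (simp add: c_def inf.absorb2)
  \<comment> \<open>The slice parametrisations of the foliation use the inverse of \<open>c\<close>,
    while the formula for \<phi> is stated with the inverse of \<psi>; on the box they
    coincide.\<close>
  have c_inv: "chart_inv c u = chart_inv \<psi> u" if "u \<in> Z \<times> Q" for u
  proof -
    obtain p where p: "p \<in> U" "u = chart_map \<psi> p"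
      using \<open>u \<in> Z \<times> Q\<close> unfolding imU[symmetric] by blast
    then show ?thesis
      using chart_inv_chart_map[OF top\<psi>(1), of p] U\<psi>
        chart_inv_chart_map[OF manifold_chart(1)[OF M cM], of p] by (auto simp: c_def)
  qed
  let ?M = "open_submanifold M U" and ?N = "open_submanifold N (\<phi> ` U)"
  note \<phi>U = diffeomorphism_image_open[OF \<phi> U]
  have topM: "mpoints ?M = U"
    using openin_subset[OF U] by (auto simp: open_submanifold_def)
  have fol: "foliated_atlas ?M {c}"
    unfolding foliated_atlas_def
  proof (intro conjI ballI)
    show "{c} \<subseteq> matlas ?M" "(\<Union>c\<in>{c}. chart_dom c) = mpoints ?M"
      using cM topM by (auto simp: open_submanifold_def c_def)
    show "\<exists>Z Q. connected Z \<and> chart_map d ` chart_dom d = Z \<times> Q" if "d \<in> {c}" for d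
      using that imU Z(2) by (auto simp: c_def)
    fix d d' p assume "d \<in> {c}" "d' \<in> {c}" "p \<in> chart_dom d \<inter> chart_dom d'"
    \<comment> \<open>With a single chart the coordinate change is the identity, so
      \<open>W = U\<close> serves for every point.\<close>
    moreover have "openin (mtop ?M) U"
      using topM openin_topspace by metis
    ultimately show "\<exists>W. openin (mtop ?M) W \<and> p \<in> W \<and> W \<subseteq> chart_dom d \<inter> chart_dom d' \<and>
        (\<forall>x\<in>W. \<forall>y\<in>W. snd (chart_map d x) = snd (chart_map d y) \<longrightarrow>
                       snd (chart_map d' x) = snd (chart_map d' y))"
      by (intro exI[of _ U]) (simp add: c_def)
  qed
  have conf: "conformal_forms (pullback_metric ?N (\<phi> \<circ> slice_param c q) z)
      (pullback_metric ?M (slice_param c q) z)"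
    if p: "p \<in> U" and zq: "chart_map \<psi> p = (z, q)" for p z q
  proof -
    have zZ: "z \<in> Z" and qQ: "q \<in> Q"
      using p zq by (auto simp: U_def)
    have near: "\<forall>\<^sub>F w in nhds z. w \<in> Z"
      using eventually_nhds_in_open[OF Z(1) zZ] .
    have inD: "(w, q) \<in> D" if "w \<in> Z" for w
      using that qQ ZQ by auto
    have j: "slice_param c q w = chart_inv \<psi> (w, q)" if "w \<in> Z" for w
      using c_inv that qQ by (simp add: slice_param_def)
    have jz: "slice_param c q z = p"
      using j[OF zZ] chart_inv_chart_map[OF top\<psi>(1), of p] p U\<psi> zq by auto
    \<comment> \<open>The full slice of \<open>D\<close>, on which the hypothesis asserts
      holomorphy.\<close>
    define S where "S = {w. (w, q) \<in> D}"
    have "open ((\<lambda>w. (w, q)) -` D)"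
      using openD by (intro open_vimage continuous_intros)
    then have S: "open S"
      by (simp add: S_def vimage_def)
    have hS: "(\<lambda>w. h (w, q)) holomorphic_on S"
      using hol by (simp add: S_def D_def)
    \<comment> \<open>On a fixed slice the second coordinates agree already, so equal values of
      \<open>h\<close> mean equal points in the chart \<psi>'; then \<psi>', \<phi> and \<psi> are
      undone in turn.\<close>
    have "inj_on (\<lambda>w. h (w, q)) S"
    proof (rule inj_onI)
      fix a b assume ab: "a \<in> S" "b \<in> S" "h (a, q) = h (b, q)"
      then have D: "(a, q) \<in> D" "(b, q) \<in> D"
        by (auto simp: S_def)
      then have "chart_map \<psi>' (\<phi> (chart_inv \<psi> (a, q))) = chart_map \<psi>' (\<phi> (chart_inv \<psi> (b, q)))"
        using h ab(3) by simp
      then have "\<phi> (chart_inv \<psi> (a, q)) = \<phi> (chart_inv \<psi> (b, q))"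
        using topological_chart_inj_on[OF top\<psi>'(1)] D_inv(2) D by (meson inj_onD)
      then have "chart_inv \<psi> (a, q) = chart_inv \<psi> (b, q)"
        using inj\<phi> D_inv(1) D dom\<psi> by (meson inj_onD subsetD)
      then show "a = b"
        using D_inv(3) D by (metis Pair_inject)
    qed
    then have h0: "deriv (\<lambda>w. h (w, q)) z \<noteq> 0" (is "?d \<noteq> 0")
      using holomorphic_injective_imp_regular[OF hS S] inD[OF zZ] by (simp add: S_def)
    have "((\<lambda>w. h (w, q)) has_derivative (*) ?d) (at z)"
      using holomorphic_derivI[OF hS S] inD[OF zZ] by (simp add: S_def has_field_derivative_def)
    \<comment> \<open>The complex derivative is used as a real-linear map; the constant second
      coordinate contributes \<open>0\<close>, so the image stays tangent to a slice of
      \<psi>'.\<close>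
    then have "((\<lambda>w. (h (w, q), q)) has_derivative (\<lambda>v. (?d * v, 0))) (at z)"
      by (auto intro!: derivative_eq_intros)
    moreover have "\<forall>\<^sub>F w in nhds z. (h (w, q), q) = (chart_map \<psi>' \<circ> (\<phi> \<circ> slice_param c q)) w"
      using near by eventually_elim (simp add: h inD j)
    ultimately have der': "((chart_map \<psi>' \<circ> (\<phi> \<circ> slice_param c q)) has_derivative (\<lambda>v. (?d * v, 0))) (at z)"
      by (rule has_derivative_transform_nhds)
    have "\<forall>\<^sub>F w in nhds z. (\<phi> \<circ> slice_param c q) w \<in> chart_dom \<psi>'"
      using near by eventually_elim (simp add: D_inv inD j)
    from pullback_metric_open_submanifold_eq[OF N \<psi>'N this der' \<phi>U]
    have pN: "pullback_metric ?N (\<phi> \<circ> slice_param c q) z v w =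
        mmetric N \<psi>' (\<phi> p) (?d * v, 0) (?d * w, 0)" for v w
      using p jz by simp
    have "((\<lambda>w. (w, q)) has_derivative (\<lambda>v. (v, 0))) (at z)"
      by (auto intro!: derivative_eq_intros)
    moreover have "\<forall>\<^sub>F w in nhds z. (w, q) = (chart_map \<psi> \<circ> slice_param c q) w"
      using near by eventually_elim (simp add: D_inv inD j)
    ultimately have der: "((chart_map \<psi> \<circ> slice_param c q) has_derivative (\<lambda>v. (v, 0))) (at z)"
      by (rule has_derivative_transform_nhds)
    have "\<forall>\<^sub>F w in nhds z. slice_param c q w \<in> chart_dom \<psi>"
      using near by eventually_elim (simp add: D_inv inD j)
    from pullback_metric_open_submanifold_eq[OF M \<psi>M this der U]
    have pM: "pullback_metric ?M (slice_param c q) z v w = mmetric M \<psi> p (v, 0) (w, 0)" for v w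
      using p jz by simp
    obtain r where r: "r > 0" "\<And>v w. mmetric M \<psi> p (v, 0) (w, 0) = r * inner v w"
      using foliated_conformal_chart_metric[OF M \<psi>(1)] p U\<psi> by blast
    have "\<phi> p \<in> chart_dom \<psi>'"
      using D_inv(2)[OF inD[OF zZ]] jz j[OF zZ] by simp
    then obtain s where s: "s > 0" "\<And>v w. mmetric N \<psi>' (\<phi> p) (v, 0) (w, 0) = s * inner v w"
      using foliated_conformal_chart_metric[OF N \<psi>'(1)] by blast
    \<comment> \<open>Complex multiplication is a similarity of the plane: this is where holomorphy
      yields conformality.\<close>
    have mult: "inner (a * v) (a * w) = (cmod a)\<^sup>2 * inner v w" for a v w :: complex
      unfolding inner_complex_def cmod_power2 by (simp add: power2_eq_square algebra_simps)
    show ?thesis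
      unfolding conformal_forms_def
    \<comment> \<open>The pullback from \<open>N\<close> is \<open>s * (cmod ?d)\<^sup>2\<close>
      times the Euclidean form and that from \<open>M\<close> is \<open>r\<close> times it; the
      witness is their quotient.\<close>
    proof (intro exI[of _ "s * (cmod ?d)\<^sup>2 / r"] conjI allI)
      show "s * (cmod ?d)\<^sup>2 / r > 0"
        using r(1) s(1) h0 by simp
      show "pullback_metric ?N (\<phi> \<circ> slice_param c q) z v w =
          s * (cmod ?d)\<^sup>2 / r * pullback_metric ?M (slice_param c q) z v w" for v w
        using r s by (simp add: pN pM mult)
    qed
  qed
  \<comment> \<open>Conformality on a leaf is a pointwise condition at its points in chart domains,
    and \<open>conf\<close> covers every point of \<open>U\<close>, the domain of
    \<open>c\<close>.\<close>
  have "conformal_on_leaf ?M ?N \<phi> {c} L" for L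
    unfolding conformal_on_leaf_def Let_def using conf by (auto simp: c_def)
  then have "leafwise_conformal ?M ?N \<phi>"
    using diffeomorphism_open_submanifold[OF M N \<phi> U] fol unfolding leafwise_conformal_def by blast
  then show "\<exists>U. openin (mtop M) U \<and> x \<in> U \<and>
      leafwise_conformal (open_submanifold M U) (open_submanifold N (\<phi> ` U)) \<phi>"
    using U xU by blast
qed

end
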